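(* Let $X$ be a Fréchet sequence space over $\mathbb{K}\in\{\mathbb{R},\mathbb{C}\}$ in which $(e_n)_{n\ge 0}$ is a basis, and let $(\Omega,\mathcal{F},\mu,\tau)$ be a measure-preserving dynamical system. Let $k\ge 1$, let $(A_1,\dots,A_k)$ be a measurable partition of $\Omega$ with $\mu(A_l)>0$ for every $1\le l\le k$, and let $w^{(l)}=(w^{(l)}_n)_{n\ge1}$, $1\le l\le k$, be sequences of nonzero scalars in $\mathbb{K}$ for which the corresponding weighted shifts $B_{w^{(l)}}$ are continuous on $X$. For $\omega\in\Omega$ put $T(\omega)=B_{w^{(l)}}$ if $\omega\in A_l$, $T_n(\omega)=T(\tau^{n-1}\omega)\cdots T(\tau\omega)T(\omega)$ for $n\ge1$, and $\varepsilon_n(\omega)=w^{(l)}_n$ if $\omega\in A_l$, for $n\ge1$. Then for every $\omega\in\Omega$ the following assertions are equivalent: (1) the sequence $(T_n(\omega))_{n\ge1}$ is universal; (2) the sequence $(T_n(\omega))_{n\ge1}$ is weakly mixing; (3) there exists a strictly increasing sequence of positive integers $(n_i)_{i\ge1}$ (depending on $\omega$) such that for every $j\ge0$, $$\left(\prod_{l=1}^{n_i+j}\varepsilon_l(\tau^{n_i+j-l}\omega)\right)^{-1}e_{n_i+j}\longrightarrow 0\quad\text{in }X\text{ as } i\to\infty .$$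
   Context: A measure-preserving dynamical system $(\Omega,\mathcal{F},\mu,\tau)$ is a probability space with a measurable map $\tau:\Omega\to\Omega$ such that $\mu(\tau^{-1}(B))=\mu(B)$ for all $B\in\mathcal{F}$. A Fréchet sequence space $X$ is a linear subspace of $\mathbb{K}^{\mathbb{Z}_+}$ ($\mathbb{Z}_+=\{0,1,2,\dots\}$) endowed with a Fréchet space topology (complete, given by a separating increasing sequence of seminorms) such that the embedding $X\to\mathbb{K}^{\mathbb{Z}_+}$ is continuous, i.e. convergence in $X$ implies coordinatewise convergence. $e_n$ is the sequence with $e_n(j)=1$ if $j=n$ and $0$ otherwise; "$(e_n)_{n\ge0}$ is a basis" means each $e_n\in X$ and $(e_n)_{n\geq 0}$ is a (Schauder) basis of $X$. The weighted shift $B_w$ associated with a sequence $w=(w_n)_{n\ge1}$ of nonzero scalars is given by $B_we_0=0$ and $B_we_n=w_ne_{n-1}$ for $n\ge1$. A sequence $(S_n)_{n\ge1}$ of continuous maps on a metric space $X$ is universal if there is $x\in X$ such that $\{S_nx:n\ge1\}$ is dense in $X$; it is weakly mixing if for all nonempty open sets $U_1,U_2,V_1,V_2\subset X$ there is $n\ge1$ with $S_n(U_1)\cap V_1\ne\emptyset$ and $S_n(U_2)\cap V_2\neq\emptyset$. *)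

theory Defs
  imports "HOL-Probability.Probability" "HOL-Library.Function_Algebras"
begin

text \<open>
  Scalars are a type of sort \<open>{real_normed_field, euclidean_space}\<close>. Both \<open>real\<close> and
  \<open>complex\<close> belong to it; by the Frobenius theorem they are, up to isomorphism of normed fields,
  the only ones. Sequences are functions \<open>nat \<Rightarrow> 'k\<close> with pointwise addition.
\<close>

definition seq_scale :: "'k::field \<Rightarrow> (nat \<Rightarrow> 'k) \<Rightarrow> nat \<Rightarrow> 'k"
  where "seq_scale c x = (\<lambda>n. c * x n)"

lemma vector_space_seq_scale: "vector_space seq_scale"
  by unfold_locales (auto simp: seq_scale_def plus_fun_def fun_eq_iff algebra_simps)

definition unit_seq :: "nat \<Rightarrow> nat \<Rightarrow> 'k::field"
  where "unit_seq n = (\<lambda>j. if j = n then 1 else 0)"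


subsection \<open>Frechet sequence spaces\<close>

definition seminorm_on :: "(nat \<Rightarrow> 'k::real_normed_field) set \<Rightarrow> ((nat \<Rightarrow> 'k) \<Rightarrow> real) \<Rightarrow> bool"
  where "seminorm_on X p \<longleftrightarrow>
    (\<forall>x\<in>X. 0 \<le> p x) \<and>
    (\<forall>x\<in>X. \<forall>y\<in>X. p (x + y) \<le> p x + p y) \<and>
    (\<forall>c. \<forall>x\<in>X. p (seq_scale c x) = norm c * p x)"

text \<open>
  As the seminorms increase, the balls of the single seminorms are a neighbourhood base of the
  topology they generate. A sequence is Cauchy in the usual translation-invariant metric
  iff it is Cauchy for every seminorm.
\<close>

definition frechet_seminorms ::
    "(nat \<Rightarrow> 'k::real_normed_field) topology \<Rightarrow> (nat \<Rightarrow> (nat \<Rightarrow> 'k) \<Rightarrow> real) \<Rightarrow> bool"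
  where "frechet_seminorms T p \<longleftrightarrow>
    (\<forall>m. seminorm_on (topspace T) (p m)) \<and>
    (\<forall>m. \<forall>x\<in>topspace T. p m x \<le> p (Suc m) x) \<and>
    (\<forall>x\<in>topspace T. (\<forall>m. p m x = 0) \<longrightarrow> x = 0) \<and>
    (\<forall>U. openin T U \<longleftrightarrow>
       U \<subseteq> topspace T \<and> (\<forall>x\<in>U. \<exists>m. \<exists>r>0. {y \<in> topspace T. p m (y - x) < r} \<subseteq> U)) \<and>
    (\<forall>s. range s \<subseteq> topspace T \<and>
         (\<forall>m. \<forall>r>0. \<exists>N. \<forall>i\<ge>N. \<forall>j\<ge>N. p m (s i - s j) < r) \<longrightarrow>
         (\<exists>x. limitin T s x sequentially))"

text \<open>A Frechet sequence space is represented by its topology; the underlying set is \<open>topspace T\<close>.\<close>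

definition frechet_sequence_space :: "(nat \<Rightarrow> 'k::real_normed_field) topology \<Rightarrow> bool"
  where "frechet_sequence_space T \<longleftrightarrow>
    module.subspace seq_scale (topspace T) \<and>
    (\<exists>p. frechet_seminorms T p) \<and>
    continuous_map T (product_topology (\<lambda>_. euclidean) UNIV) (\<lambda>x. x)"

definition schauder_basis ::
    "(nat \<Rightarrow> 'k::real_normed_field) topology \<Rightarrow> (nat \<Rightarrow> nat \<Rightarrow> 'k) \<Rightarrow> bool"
  where "schauder_basis T b \<longleftrightarrow>
    (\<forall>n. b n \<in> topspace T) \<and>
    (\<forall>x\<in>topspace T. \<exists>!a. limitin T (\<lambda>N. \<Sum>n<N. seq_scale (a n) (b n)) x sequentially)"


subsection \<open>Weighted shifts\<close>

text \<open>
  The weights are indexed from 1; the value \<open>w 0\<close> is irrelevant. The formula is the extension of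
  \<open>B\<^sub>w e\<^sub>0 = 0\<close>, \<open>B\<^sub>w e\<^sub>n = w\<^sub>n e\<^sub>n\<^sub>-\<^sub>1\<close>; see \<open>weighted_shift_unique\<close> below.
\<close>

definition weighted_shift :: "(nat \<Rightarrow> 'k::field) \<Rightarrow> (nat \<Rightarrow> 'k) \<Rightarrow> nat \<Rightarrow> 'k"
  where "weighted_shift w x = (\<lambda>n. w (Suc n) * x (Suc n))"

lemma weighted_shift_unit_seq_0: "weighted_shift w (unit_seq 0) = 0"
  by (simp add: weighted_shift_def unit_seq_def zero_fun_def)

lemma weighted_shift_unit_seq:
  "n \<ge> 1 \<Longrightarrow> weighted_shift w (unit_seq n) = seq_scale (w n) (unit_seq (n - 1))"
  by (auto simp: weighted_shift_def unit_seq_def seq_scale_def fun_eq_iff)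

lemma weighted_shift_add: "weighted_shift w (x + y) = weighted_shift w x + weighted_shift w y"
  by (simp add: weighted_shift_def plus_fun_def fun_eq_iff algebra_simps)

lemma weighted_shift_scale: "weighted_shift w (seq_scale c x) = seq_scale c (weighted_shift w x)"
  by (simp add: weighted_shift_def seq_scale_def fun_eq_iff algebra_simps)

lemma sum_seq_apply: "(\<Sum>n\<in>A. f n :: nat \<Rightarrow> 'k::field) j = (\<Sum>n\<in>A. f n j)"
  by (induction A rule: infinite_finite_induct) (auto simp: plus_fun_def zero_fun_def)

lemma limitin_coordinate:
  assumes "frechet_sequence_space T" "limitin T s x sequentially"
  shows "(\<lambda>i. s i j) \<longlonglongrightarrow> x j"
proof -
  have "continuous_map T (product_topology (\<lambda>_::nat. euclidean) UNIV) (\<lambda>x. x)"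
    using assms(1) by (simp add: frechet_sequence_space_def)
  from continuous_map_limit[OF this assms(2)]
  have "limitin (product_topology (\<lambda>_::nat. euclidean) UNIV) s x sequentially"
    by (simp add: o_def)
  then show ?thesis
    by (simp add: limitin_componentwise)
qed

lemma weighted_shift_unique:
  fixes T :: "(nat \<Rightarrow> 'k::real_normed_field) topology"
  assumes T: "frechet_sequence_space T" and b: "schauder_basis T unit_seq"
    and S: "continuous_map T T S"
    and add: "\<And>x y. x \<in> topspace T \<Longrightarrow> y \<in> topspace T \<Longrightarrow> S (x + y) = S x + S y"
    and scale: "\<And>c x. x \<in> topspace T \<Longrightarrow> S (seq_scale c x) = seq_scale c (S x)"
    and e0: "S (unit_seq 0) = 0"
    and en: "\<And>n. n \<ge> 1 \<Longrightarrow> S (unit_seq n) = seq_scale (w n) (unit_seq (n - 1))"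
    and x: "x \<in> topspace T"
  shows "S x = weighted_shift w x"
proof -
  interpret vector_space "seq_scale :: 'k \<Rightarrow> _" by (rule vector_space_seq_scale)
  have sub: "subspace (topspace T)" using T by (simp add: frechet_sequence_space_def)
  have eT: "unit_seq n \<in> topspace T" for n using b by (simp add: schauder_basis_def)
  obtain a where a: "limitin T (\<lambda>N. \<Sum>n<N. seq_scale (a n) (unit_seq n)) x sequentially"
    using b x unfolding schauder_basis_def by blast
  have W: "S (unit_seq n) = weighted_shift w (unit_seq n)" for n
    using e0 en[of n] weighted_shift_unit_seq_0[of w] weighted_shift_unit_seq[of n w]
    by (cases "n = 0") auto
  have "weighted_shift w 0 = 0" by (simp add: weighted_shift_def zero_fun_def)
  moreover have "S 0 = 0"
    using scale[OF eT[of 0], of 0] by (simp add: seq_scale_def zero_fun_def)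
  ultimately have part: "S (\<Sum>n<N. seq_scale (a n) (unit_seq n))
      = weighted_shift w (\<Sum>n<N. seq_scale (a n) (unit_seq n))" for N
    by (induction N)
      (simp_all add: add scale eT W weighted_shift_add weighted_shift_scale
        subspace_sum[OF sub] subspace_scale[OF sub])
  have L: "limitin T (\<lambda>N. S (\<Sum>n<N. seq_scale (a n) (unit_seq n))) (S x) sequentially"
    using continuous_map_limit[OF S a] by (simp add: o_def)
  show ?thesis
  proof
    fix j
    have "(\<lambda>N. S (\<Sum>n<N. seq_scale (a n) (unit_seq n)) j) \<longlonglongrightarrow> S x j"
      by (rule limitin_coordinate[OF T L])
    moreover have "(\<lambda>N. S (\<Sum>n<N. seq_scale (a n) (unit_seq n)) j) \<longlonglongrightarrow> weighted_shift w x j"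
      unfolding part unfolding weighted_shift_def
      by (intro tendsto_intros limitin_coordinate[OF T a])
    ultimately show "S x j = weighted_shift w x j" by (rule LIMSEQ_unique)
  qed
qed


subsection \<open>Dynamics\<close>

definition measure_preserving_system :: "'a measure \<Rightarrow> ('a \<Rightarrow> 'a) \<Rightarrow> bool"
  where "measure_preserving_system M \<tau> \<longleftrightarrow>
    prob_space M \<and> \<tau> \<in> measurable M M \<and>
    (\<forall>B\<in>sets M. emeasure M (\<tau> -` B \<inter> space M) = emeasure M B)"

definition measurable_partition :: "'a measure \<Rightarrow> nat \<Rightarrow> (nat \<Rightarrow> 'a set) \<Rightarrow> bool"
  where "measurable_partition M k A \<longleftrightarrow>
    (\<forall>l\<in>{1..k}. A l \<in> sets M) \<and> disjoint_family_on A {1..k} \<and> (\<Union>l\<in>{1..k}. A l) = space M"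

definition cell :: "nat \<Rightarrow> (nat \<Rightarrow> 'a set) \<Rightarrow> 'a \<Rightarrow> nat"
  where "cell k A \<omega> = (THE l. l \<in> {1..k} \<and> \<omega> \<in> A l)"

lemma cell_eq:
  assumes "measurable_partition M k A" "l \<in> {1..k}" "\<omega> \<in> A l"
  shows "cell k A \<omega> = l"
  unfolding cell_def
  using assms
  by (intro the_equality) (unfold measurable_partition_def disjoint_family_on_def, blast+)

definition random_shift ::
    "nat \<Rightarrow> (nat \<Rightarrow> 'a set) \<Rightarrow> (nat \<Rightarrow> nat \<Rightarrow> 'k::field) \<Rightarrow> 'a \<Rightarrow> (nat \<Rightarrow> 'k) \<Rightarrow> nat \<Rightarrow> 'k"
  where "random_shift k A w \<omega> = weighted_shift (w (cell k A \<omega>))"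

definition random_weight ::
    "nat \<Rightarrow> (nat \<Rightarrow> 'a set) \<Rightarrow> (nat \<Rightarrow> nat \<Rightarrow> 'k) \<Rightarrow> nat \<Rightarrow> 'a \<Rightarrow> 'k"
  where "random_weight k A w n \<omega> = w (cell k A \<omega>) n"

text \<open>\<open>random_product \<tau> R n \<omega>\<close> is \<open>R (\<tau>\<^sup>n\<^sup>-\<^sup>1 \<omega>) \<circ> \<dots> \<circ> R (\<tau> \<omega>) \<circ> R \<omega>\<close>.\<close>

primrec random_product :: "('a \<Rightarrow> 'a) \<Rightarrow> ('a \<Rightarrow> 'x \<Rightarrow> 'x) \<Rightarrow> nat \<Rightarrow> 'a \<Rightarrow> 'x \<Rightarrow> 'x"
  where
    "random_product \<tau> R 0 \<omega> = id"
  | "random_product \<tau> R (Suc n) \<omega> = R ((\<tau> ^^ n) \<omega>) \<circ> random_product \<tau> R n \<omega>"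

definition universal :: "'x topology \<Rightarrow> (nat \<Rightarrow> 'x \<Rightarrow> 'x) \<Rightarrow> bool"
  where "universal T S \<longleftrightarrow> (\<exists>x\<in>topspace T. T closure_of {S n x | n. n \<ge> 1} = topspace T)"

definition weakly_mixing :: "'x topology \<Rightarrow> (nat \<Rightarrow> 'x \<Rightarrow> 'x) \<Rightarrow> bool"
  where "weakly_mixing T S \<longleftrightarrow>
    (\<forall>U1 U2 V1 V2.
      openin T U1 \<and> openin T U2 \<and> openin T V1 \<and> openin T V2 \<and>
      U1 \<noteq> {} \<and> U2 \<noteq> {} \<and> V1 \<noteq> {} \<and> V2 \<noteq> {} \<longrightarrow>
      (\<exists>n\<ge>1. S n ` U1 \<inter> V1 \<noteq> {} \<and> S n ` U2 \<inter> V2 \<noteq> {}))"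

end

theory Submission
  imports Defs
begin

text \<open>
  Evaluating the random product along the orbit of \<open>\<omega>\<close> gives
  \<open>(T\<^sub>n x)(j) = c n j * x (n + j)\<close>, where \<open>c n j\<close> is the product of the weights
  \<open>\<epsilon>\<^sub>l(\<tau>\<^sup>n\<^sup>+\<^sup>j\<^sup>-\<^sup>l \<omega>)\<close> with \<open>j < l \<le> n + j\<close> and hence nonzero. The product in the third
  assertion has \<open>j\<close> additional factors, each of them one of finitely many nonzero numbers that do
  not depend on \<open>n\<close>. Omitting them changes neither the convergence nor the limit \<open>0\<close>. It remains
  to study continuous maps of the form \<open>(S\<^sub>n x)(j) = c n j * x (n + j)\<close>, for which the three assertions are
  equivalent whatever the nonzero scalars \<open>c n j\<close> are.

  If the orbit \<open>S\<^sub>n x\<close> of some \<open>x\<close> is dense, it approaches vectors whose first coordinates are all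
  equal to a constant; a large constant makes the time \<open>n\<close> at which this occurs late. At such
  times \<open>n\<close> the numbers \<open>c n j * x (n + j)\<close> with small \<open>j\<close> are bounded away from \<open>0\<close>, so \<open>e\<^sub>n\<^sub>+\<^sub>j / c n j\<close> is dominated in every seminorm by a fixed multiple of
  \<open>x (n + j) e\<^sub>n\<^sub>+\<^sub>j\<close>, a term of the basis expansion of \<open>x\<close>, which tends to \<open>0\<close>
  (\<open>universal_imp_tendsto\<close>).

  If \<open>e\<^sub>n\<^sub>+\<^sub>j / c n j\<close> tends to \<open>0\<close> along some \<open>n = m\<^sub>i\<close>, then the preimages
  \<open>\<Sum>\<^sub>j v\<^sub>j e\<^sub>n\<^sub>+\<^sub>j / c n j\<close> of a finitely supported sequence \<open>v\<close> tend to \<open>0\<close>, while \<open>S\<^sub>n\<close>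
  eventually annihilates a given finitely supported \<open>u\<close>. So \<open>u\<close> plus the preimage is close to
  \<open>u\<close> and is mapped to \<open>v\<close>. This happens for all large \<open>i\<close>, hence for two pairs of open sets at
  once, and the finitely supported sequences are dense (\<open>tendsto_imp_weakly_mixing\<close>).

  A weakly mixing sequence is topologically transitive. As \<open>X\<close> is completely metrizable and second
  countable, the Baire category theorem gives a point with dense orbit
  (\<open>weakly_mixing_imp_universal\<close>).
\<close>

section \<open>Topological transitivity and dense orbits\<close>

text \<open>
  Birkhoff's transitivity argument: for each nonempty basic open \<open>V\<close> the points whose orbit meets \<open>V\<close> form
  an open set, dense by transitivity, and by Baire a single point lies in all of these sets.
\<close>

lemma transitive_imp_universal:
  assumes compl: "completely_metrizable_space X" and sec: "second_countable X"
    and ne: "topspace X \<noteq> {}"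
    and cont: "\<And>n. continuous_map X X (S n)"
    and trans: "\<And>U V. openin X U \<Longrightarrow> openin X V \<Longrightarrow> U \<noteq> {} \<Longrightarrow> V \<noteq> {} \<Longrightarrow>
                  \<exists>n\<ge>1. S n ` U \<inter> V \<noteq> {}"
  shows "universal X S"
proof -
  obtain \<B> where \<B>: "countable \<B>" "\<And>V. V \<in> \<B> \<Longrightarrow> openin X V"
    "\<And>U x. openin X U \<Longrightarrow> x \<in> U \<Longrightarrow> \<exists>V\<in>\<B>. x \<in> V \<and> V \<subseteq> U"
    using sec unfolding second_countable_def by metis
  define G where "G V = (\<Union>n\<in>{1..}. {x \<in> topspace X. S n x \<in> V})" for V
  have "X closure_of (\<Inter>(G ` (\<B> - {{}}))) = topspace X"
  proof (rule Baire_category)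
    fix W assume "W \<in> G ` (\<B> - {{}})"
    then obtain V where V: "V \<in> \<B>" "V \<noteq> {}" "W = G V" by auto
    have "openin X (G V)"
      unfolding G_def using cont \<B>(2)[OF V(1)]
      by (intro openin_Union) (auto intro: openin_continuous_map_preimage)
    moreover have "G V \<inter> U \<noteq> {}" if U: "openin X U" "U \<noteq> {}" for U
    proof -
      obtain n x where "n \<ge> 1" "x \<in> U" "S n x \<in> V"
        using trans[OF U(1) \<B>(2)[OF V(1)] U(2) V(2)] by auto
      then show ?thesis
        using openin_subset[OF U(1)] unfolding G_def by auto
    qed
    ultimately show "openin X W \<and> X closure_of W = topspace X"
      unfolding V(3) dense_intersects_open by blast
  qed (use compl \<B>(1) in auto)
  then obtain x where x: "x \<in> topspace X" "x \<in> \<Inter>(G ` (\<B> - {{}}))"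
    using ne unfolding dense_intersects_open by (metis disjoint_iff openin_topspace)
  have "{S n x | n. n \<ge> 1} \<inter> U \<noteq> {}" if U: "openin X U" "U \<noteq> {}" for U
  proof -
    obtain V where V: "V \<in> \<B>" "V \<noteq> {}" "V \<subseteq> U" using \<B>(3)[OF U(1)] U(2) by blast
    then have "x \<in> G V" using x(2) by auto
    then show ?thesis using V(3) unfolding G_def by auto
  qed
  then show ?thesis
    using x(1) unfolding universal_def dense_intersects_open by blast
qed


section \<open>Frechet sequence spaces\<close>

locale frechet_seq =
  fixes X :: "(nat \<Rightarrow> 'k::real_normed_field) topology" and p :: "nat \<Rightarrow> (nat \<Rightarrow> 'k) \<Rightarrow> real"
  assumes frechet: "frechet_sequence_space X" and seminorms: "frechet_seminorms X p"
begin

sublocale vs: vector_space "seq_scale :: 'k \<Rightarrow> _"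
  by (rule vector_space_seq_scale)

lemma subspace_X: "vs.subspace (topspace X)"
  using frechet by (simp add: frechet_sequence_space_def)

lemma zero_mem: "0 \<in> topspace X"
  and add_mem: "x \<in> topspace X \<Longrightarrow> y \<in> topspace X \<Longrightarrow> x + y \<in> topspace X"
  and diff_mem: "x \<in> topspace X \<Longrightarrow> y \<in> topspace X \<Longrightarrow> x - y \<in> topspace X"
  and scale_mem: "x \<in> topspace X \<Longrightarrow> seq_scale c x \<in> topspace X"
  using vs.subspace_0 vs.subspace_add vs.subspace_diff vs.subspace_scale subspace_X by blast+

lemma sum_mem: "(\<And>i. i \<in> I \<Longrightarrow> f i \<in> topspace X) \<Longrightarrow> (\<Sum>i\<in>I. f i) \<in> topspace X"
  by (rule vs.subspace_sum[OF subspace_X])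

lemma p_nonneg: "x \<in> topspace X \<Longrightarrow> 0 \<le> p m x"
  and p_add: "x \<in> topspace X \<Longrightarrow> y \<in> topspace X \<Longrightarrow> p m (x + y) \<le> p m x + p m y"
  and p_scale: "x \<in> topspace X \<Longrightarrow> p m (seq_scale c x) = norm c * p m x"
  using seminorms by (auto simp: frechet_seminorms_def seminorm_on_def)

lemma p_zero: "p m 0 = 0"
  using p_scale[OF zero_mem, of m 0] by (simp add: vs.scale_zero_left)

lemma p_sum:
  "(\<And>i. i \<in> I \<Longrightarrow> f i \<in> topspace X) \<Longrightarrow> p m (\<Sum>i\<in>I. f i) \<le> (\<Sum>i\<in>I. p m (f i))"
proof (induction I rule: infinite_finite_induct)
  case (insert i I)
  have "p m (f i + sum f I) \<le> p m (f i) + p m (sum f I)"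
    using insert.prems by (intro p_add sum_mem) auto
  also have "\<dots> \<le> p m (f i) + (\<Sum>i\<in>I. p m (f i))" using insert by auto
  finally show ?case by (simp only: sum.insert[OF insert.hyps])
qed (simp_all add: p_zero)

lemma p_commute:
  assumes "x \<in> topspace X" "y \<in> topspace X"
  shows "p m (x - y) = p m (y - x)"
proof -
  have "x - y = seq_scale (-1) (y - x)"
    by (simp add: seq_scale_def fun_eq_iff)
  then show ?thesis
    using p_scale[OF diff_mem[OF assms(2,1)], of m "-1"] by simp
qed

lemma p_triangle:
  assumes "x \<in> topspace X" "y \<in> topspace X" "z \<in> topspace X"
  shows "p m (x - z) \<le> p m (x - y) + p m (y - z)"
  using p_add[OF diff_mem[OF assms(1,2)] diff_mem[OF assms(2,3)], of m] by simp

lemma p_mono: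
  assumes "x \<in> topspace X" "m \<le> n"
  shows "p m x \<le> p n x"
proof -
  have "p m x \<le> p (Suc m) x" for m
    using seminorms assms(1) by (simp add: frechet_seminorms_def)
  then show ?thesis using lift_Suc_mono_le[of "\<lambda>m. p m x"] assms(2) by blast
qed

lemma p_separating: "x \<in> topspace X \<Longrightarrow> (\<And>m. p m x = 0) \<Longrightarrow> x = 0"
  using seminorms by (simp add: frechet_seminorms_def)

lemma openin_iff:
  "openin X U \<longleftrightarrow>
    U \<subseteq> topspace X \<and> (\<forall>x\<in>U. \<exists>m. \<exists>r>0. {y \<in> topspace X. p m (y - x) < r} \<subseteq> U)"
  using seminorms unfolding frechet_seminorms_def by blast

lemma complete:
  assumes "range s \<subseteq> topspace X"
    and "\<And>m r. r > 0 \<Longrightarrow> \<exists>N. \<forall>i\<ge>N. \<forall>j\<ge>N. p m (s i - s j) < r"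
  obtains x where "limitin X s x sequentially"
proof -
  have "\<forall>s. range s \<subseteq> topspace X \<and>
         (\<forall>m. \<forall>r>0. \<exists>N. \<forall>i\<ge>N. \<forall>j\<ge>N. p m (s i - s j) < r) \<longrightarrow>
         (\<exists>x. limitin X s x sequentially)"
    using seminorms unfolding frechet_seminorms_def by (elim conjE)
  with assms have "\<exists>x. limitin X s x sequentially" by simp
  with that show thesis by blast
qed

lemma openin_ball:
  assumes "x \<in> topspace X"
  shows "openin X {y \<in> topspace X. p m (y - x) < r}"
  unfolding openin_iff
proof (intro conjI ballI)
  fix y assume "y \<in> {y \<in> topspace X. p m (y - x) < r}"
  then have y: "y \<in> topspace X" "p m (y - x) < r" by auto
  have "p m (z - x) < r" if "z \<in> topspace X" "p m (z - y) < r - p m (y - x)" for z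
    using p_triangle[OF that(1) y(1) assms, of m] that(2) by simp
  with y show "\<exists>n. \<exists>s>0. {z \<in> topspace X. p n (z - y) < s} \<subseteq> {y \<in> topspace X. p m (y - x) < r}"
    by (intro exI[of _ m] exI[of _ "r - p m (y - x)"]) auto
qed auto

text \<open>
  As the balls of single seminorms already form a neighbourhood base, convergence can be tested on
  one seminorm at a time.
\<close>

lemma limitin_iff:
  assumes "\<And>i. s i \<in> topspace X" "x \<in> topspace X"
  shows "limitin X s x sequentially \<longleftrightarrow> (\<forall>m. (\<lambda>i. p m (s i - x)) \<longlonglongrightarrow> 0)"
proof
  assume L: "limitin X s x sequentially"
  show "\<forall>m. (\<lambda>i. p m (s i - x)) \<longlonglongrightarrow> 0"
  proof (intro allI tendstoI)
    fix m and r :: real assume "r > 0"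
    then have "x \<in> {y \<in> topspace X. p m (y - x) < r}"
      using assms(2) by (simp add: p_zero)
    then have "eventually (\<lambda>i. s i \<in> {y \<in> topspace X. p m (y - x) < r}) sequentially"
      using L openin_ball[OF assms(2)] unfolding limitin_def by blast
    then show "eventually (\<lambda>i. dist (p m (s i - x)) 0 < r) sequentially"
      by eventually_elim (use p_nonneg[OF diff_mem[OF assms(1) assms(2)]] in auto)
  qed
next
  assume L: "\<forall>m. (\<lambda>i. p m (s i - x)) \<longlonglongrightarrow> 0"
  show "limitin X s x sequentially"
    unfolding limitin_def
  proof (intro conjI allI impI)
    fix U assume "openin X U \<and> x \<in> U"
    then obtain m r where r: "r > 0" "{y \<in> topspace X. p m (y - x) < r} \<subseteq> U"
      unfolding openin_iff by blast
    have "eventually (\<lambda>i. p m (s i - x) < r) sequentially"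
      using L r(1) by (auto dest!: order_tendstoD(2))
    then show "eventually (\<lambda>i. s i \<in> U) sequentially"
      by eventually_elim (use r(2) assms(1) in auto)
  qed (use assms in auto)
qed

lemma limitin_0_iff:
  assumes "\<And>i. s i \<in> topspace X"
  shows "limitin X s 0 sequentially \<longleftrightarrow> (\<forall>m. (\<lambda>i. p m (s i)) \<longlonglongrightarrow> 0)"
  using limitin_iff[of s 0] assms zero_mem by simp

lemma openin_coordinate:
  assumes "open B"
  shows "openin X {x \<in> topspace X. x j \<in> B}"
proof -
  have "continuous_map X (product_topology (\<lambda>_::nat. euclidean) UNIV) (\<lambda>x. x)"
    using frechet by (simp add: frechet_sequence_space_def)
  then have "continuous_map X euclidean (\<lambda>x. x j)"
    by (auto simp: continuous_map_componentwise_UNIV)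
  then show ?thesis
    using assms by (auto intro: openin_continuous_map_preimage)
qed


subsection \<open>Complete metrizability\<close>

text \<open>
  Capping the \<open>m\<close>-th seminorm at \<open>1/(m+1)\<close> makes the supremum metrize the topology: a bound on the
  single value \<open>p m (x - y)\<close> also bounds all earlier seminorms by monotonicity, and all later ones
  contribute less than \<open>1/(m+1)\<close>. Outside \<open>topspace X\<close>, where the seminorms are arbitrary, the
  value is \<open>0\<close> so that the function is nonnegative and symmetric everywhere, as
  \<open>Metric_space\<close> demands.
\<close>

definition frechet_dist :: "(nat \<Rightarrow> 'k) \<Rightarrow> (nat \<Rightarrow> 'k) \<Rightarrow> real"
  where "frechet_dist x y =
    (if x \<in> topspace X \<and> y \<in> topspace X then SUP m. min (1 / real (Suc m)) (p m (x - y)) else 0)"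

lemma bdd_above_min: "bdd_above (range (\<lambda>m. min (1 / real (Suc m)) (f m)))"
  by (rule bdd_aboveI[of _ 1]) (auto simp: min_le_iff_disj)

lemma min_le_frechet_dist:
  "x \<in> topspace X \<Longrightarrow> y \<in> topspace X \<Longrightarrow> min (1 / real (Suc m)) (p m (x - y)) \<le> frechet_dist x y"
  unfolding frechet_dist_def using cSUP_upper[OF UNIV_I bdd_above_min] by simp

lemma frechet_dist_le:
  assumes "x \<in> topspace X" "y \<in> topspace X" "\<And>m. min (1 / real (Suc m)) (p m (x - y)) \<le> r"
  shows "frechet_dist x y \<le> r"
  unfolding frechet_dist_def using assms by (auto intro: cSUP_least)

lemma p_less_if_frechet_dist_less:
  assumes "x \<in> topspace X" "y \<in> topspace X" "frechet_dist x y < min (1 / real (Suc m)) r"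
  shows "p m (x - y) < r"
  using min_le_frechet_dist[OF assms(1,2), of m] assms(3) by auto

lemma frechet_dist_le_if_p_le:
  assumes "x \<in> topspace X" "y \<in> topspace X" "p m (x - y) \<le> r" "1 / real (Suc m) \<le> r"
  shows "frechet_dist x y \<le> r"
proof (rule frechet_dist_le[OF assms(1,2)])
  fix n show "min (1 / real (Suc n)) (p n (x - y)) \<le> r"
  proof (cases "n \<le> m")
    case True
    then show ?thesis
      using p_mono[OF diff_mem[OF assms(1,2)] True] assms(3) by auto
  next
    case False
    then have "1 / real (Suc n) \<le> 1 / real (Suc m)" by (auto intro!: divide_left_mono)
    then show ?thesis using assms(4) by auto
  qed
qed

lemma Metric_space_frechet_dist: "Metric_space (topspace X) frechet_dist"
proof
  show nonneg: "0 \<le> frechet_dist x y" for x y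
  proof (cases "x \<in> topspace X \<and> y \<in> topspace X")
    case True
    then have "0 \<le> min (1 / real (Suc 0)) (p 0 (x - y))" by (auto intro!: p_nonneg diff_mem)
    also have "\<dots> \<le> frechet_dist x y" using True min_le_frechet_dist by blast
    finally show ?thesis .
  qed (auto simp: frechet_dist_def)
  show "frechet_dist x y = frechet_dist y x" for x y
    unfolding frechet_dist_def by (simp add: p_commute[of x y])
  show "frechet_dist x y = 0 \<longleftrightarrow> x = y" if x: "x \<in> topspace X" and y: "y \<in> topspace X" for x y
  proof
    assume d0: "frechet_dist x y = 0"
    have "p m (x - y) = 0" for m
      using min_le_frechet_dist[OF x y, of m] p_nonneg[OF diff_mem[OF x y], of m]
      by (auto simp: d0 min_le_iff_disj)
    then show "x = y" using p_separating[OF diff_mem[OF x y]] by simp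
  next
    assume "x = y"
    then have "frechet_dist x y \<le> 0"
      using x by (intro frechet_dist_le) (auto simp: p_zero)
    then show "frechet_dist x y = 0" using nonneg[of x y] by simp
  qed
  show "frechet_dist x z \<le> frechet_dist x y + frechet_dist y z"
    if x: "x \<in> topspace X" and y: "y \<in> topspace X" and z: "z \<in> topspace X" for x y z
  proof (rule frechet_dist_le[OF x z])
    fix m
    have "min (1 / real (Suc m)) (p m (x - z))
        \<le> min (1 / real (Suc m)) (p m (x - y)) + min (1 / real (Suc m)) (p m (y - z))"
      using p_triangle[OF x y z, of m] p_nonneg[OF diff_mem[OF x y], of m]
        p_nonneg[OF diff_mem[OF y z], of m] by (smt (verit) divide_nonneg_nonneg of_nat_0_le_iff)
    also have "\<dots> \<le> frechet_dist x y + frechet_dist y z"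
      by (intro add_mono min_le_frechet_dist x y z)
    finally show "min (1 / real (Suc m)) (p m (x - z)) \<le> frechet_dist x y + frechet_dist y z" .
  qed
qed

lemma completely_metrizable: "completely_metrizable_space X"
proof -
  interpret Metric_space "topspace X" frechet_dist by (rule Metric_space_frechet_dist)
  have eq: "mtopology = X"
    unfolding topology_eq openin_mtopology openin_iff
  proof (intro allI conj_cong refl iffI ballI impI)
    fix U x assume U: "U \<subseteq> topspace X" and x: "x \<in> U"
    { assume "\<forall>x. x \<in> U \<longrightarrow> (\<exists>r>0. mball x r \<subseteq> U)"
      then obtain r where r: "r > 0" "mball x r \<subseteq> U" using x by blast
      obtain m where m: "1 / real (Suc m) < r / 2"
        using nat_approx_posE[of "r/2"] r(1) by auto
      have "y \<in> U" if y: "y \<in> topspace X" "p m (y - x) < r / 2" for y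
      proof -
        have "frechet_dist y x \<le> r / 2"
          using frechet_dist_le_if_p_le[OF y(1), of x m "r/2"] y m x U by auto
        then have "y \<in> mball x r" using y(1) x U r(1) by (auto simp: commute)
        then show ?thesis using r(2) by blast
      qed
      then show "\<exists>m. \<exists>r>0. {y \<in> topspace X. p m (y - x) < r} \<subseteq> U"
        using r(1) by (intro exI[of _ m] exI[of _ "r/2"]) auto }
    { assume "\<forall>x\<in>U. \<exists>m. \<exists>r>0. {y \<in> topspace X. p m (y - x) < r} \<subseteq> U"
      then obtain m r where r: "r > 0" "{y \<in> topspace X. p m (y - x) < r} \<subseteq> U" using x by blast
      have "mball x (min (1 / real (Suc m)) r) \<subseteq> U"
        using p_less_if_frechet_dist_less[of _ x m r] r(2) by (auto simp: commute)
      then show "\<exists>r>0. mball x r \<subseteq> U"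
        using r(1) by (intro exI[of _ "min (1 / real (Suc m)) r"]) auto }
  qed
  have "mcomplete"
    unfolding mcomplete_def
  proof (intro allI impI)
    fix s assume s: "MCauchy s"
    then have sX: "s i \<in> topspace X" for i by (auto simp: MCauchy_def)
    obtain x where "limitin X s x sequentially"
    proof (rule complete)
      show "\<exists>N. \<forall>i\<ge>N. \<forall>j\<ge>N. p m (s i - s j) < r" if "r > 0" for m and r :: real
      proof -
        have "min (1 / real (Suc m)) r > 0" using that by simp
        then obtain N where "\<And>i j. N \<le> i \<Longrightarrow> N \<le> j \<Longrightarrow> frechet_dist (s i) (s j) < min (1 / real (Suc m)) r"
          using s unfolding MCauchy_def by meson
        then show ?thesis using p_less_if_frechet_dist_less[OF sX sX] by meson
      qed
    qed (use sX in auto)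
    then show "\<exists>x. limitin mtopology s x sequentially" unfolding eq by blast
  qed
  then show ?thesis
    unfolding completely_metrizable_space_def
    using Metric_space_axioms eq by metis
qed

end


section \<open>Finitely supported sequences\<close>

definition seq_of_list :: "'k::field list \<Rightarrow> nat \<Rightarrow> 'k"
  where "seq_of_list u = (\<lambda>j. if j < length u then u ! j else 0)"

lemma seq_of_list_eq_sum:
  "seq_of_list u = (\<Sum>n<length u. seq_scale (u ! n) (unit_seq n))"
proof
  fix j
  have "(\<Sum>n<length u. seq_scale (u ! n) (unit_seq n)) j = (\<Sum>n<length u. if n = j then u ! n else 0)"
    unfolding sum_seq_apply by (intro sum.cong) (auto simp: seq_scale_def unit_seq_def)
  then show "seq_of_list u j = (\<Sum>n<length u. seq_scale (u ! n) (unit_seq n)) j"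
    by (simp add: seq_of_list_def)
qed

locale frechet_seq_basis = frechet_seq +
  assumes basis: "schauder_basis X unit_seq"
begin

lemma unit_mem: "unit_seq n \<in> topspace X"
  using basis by (simp add: schauder_basis_def)

lemma scaled_unit_mem: "seq_scale c (unit_seq n) \<in> topspace X"
  by (intro scale_mem unit_mem)

lemma seq_of_list_mem: "seq_of_list u \<in> topspace X"
  unfolding seq_of_list_eq_sum by (intro sum_mem scaled_unit_mem)

text \<open>
  The coefficients in the basis expansion are the coordinates, because convergence in \<open>X\<close> implies
  coordinatewise convergence.
\<close>

lemma limitin_partial_sums:
  assumes "x \<in> topspace X"
  shows "limitin X (\<lambda>N. \<Sum>n<N. seq_scale (x n) (unit_seq n)) x sequentially"
proof -
  obtain a where a: "limitin X (\<lambda>N. \<Sum>n<N. seq_scale (a n) (unit_seq n)) x sequentially"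
    using basis assms unfolding schauder_basis_def by blast
  have "x j = a j" for j
  proof -
    have "(\<lambda>N. (\<Sum>n<N. seq_scale (a n) (unit_seq n)) j) \<longlonglongrightarrow> x j"
      by (rule limitin_coordinate[OF frechet a])
    moreover have "(\<Sum>n<N. seq_scale (a n) (unit_seq n)) j = (\<Sum>n<N. if n = j then a n else 0)" for N
      unfolding sum_seq_apply by (intro sum.cong) (auto simp: seq_scale_def unit_seq_def)
    then have "(\<Sum>n<N. seq_scale (a n) (unit_seq n)) j = a j" if "N > j" for N
      using that by simp
    then have "eventually (\<lambda>N. (\<Sum>n<N. seq_scale (a n) (unit_seq n)) j = a j) sequentially"
      using eventually_gt_at_top[of j] by (rule eventually_mono[rotated])
    ultimately show ?thesis
      by (intro LIMSEQ_unique[OF _ tendsto_eventually])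
  qed
  then have "x = a" by blast
  with a show ?thesis by simp
qed

lemma basis_terms_tendsto_0:
  assumes "x \<in> topspace X"
  shows "(\<lambda>n. p m (seq_scale (x n) (unit_seq n))) \<longlonglongrightarrow> 0"
proof -
  define s where "s N = (\<Sum>n<N. seq_scale (x n) (unit_seq n))" for N
  have s: "s N \<in> topspace X" for N unfolding s_def by (intro sum_mem scaled_unit_mem)
  have lim: "(\<lambda>N. p m (s N - x)) \<longlonglongrightarrow> 0"
    using limitin_partial_sums[OF assms] limitin_iff[of s x, OF s assms] unfolding s_def by blast
  have lim2: "(\<lambda>N. p m (s (Suc N) - x) + p m (s N - x)) \<longlonglongrightarrow> 0"
    using tendsto_add[OF LIMSEQ_Suc[OF lim] lim] by simp
  have "p m (seq_scale (x n) (unit_seq n)) \<le> p m (s (Suc n) - x) + p m (s n - x)" for n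
  proof -
    have "seq_scale (x n) (unit_seq n) = s (Suc n) - s n" by (simp add: s_def)
    then show ?thesis
      using p_triangle[OF s assms s, of m "Suc n" n] p_commute[OF s assms, of m n] by simp
  qed
  then show ?thesis
    by (intro tendsto_sandwich[OF _ _ tendsto_const lim2])
      (auto intro!: always_eventually p_nonneg scaled_unit_mem)
qed

text \<open>
  A partial sum of the basis expansion approximates the given point, and its finitely many
  coefficients can then be moved into \<open>D\<close>. With \<open>D = UNIV\<close> this is density of the finitely
  supported sequences; a countable \<open>D\<close> yields second countability.
\<close>

lemma seq_of_list_dense:
  assumes D: "\<And>B. open B \<Longrightarrow> B \<noteq> {} \<Longrightarrow> \<exists>d\<in>D. d \<in> B"
    and U: "openin X U" "U \<noteq> {}"
  obtains u where "u \<in> lists D" "seq_of_list u \<in> U"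
proof -
  obtain x where x: "x \<in> U" using U(2) by blast
  have xX: "x \<in> topspace X" using x openin_subset[OF U(1)] by blast
  obtain m r where r: "r > 0" "{y \<in> topspace X. p m (y - x) < r} \<subseteq> U"
    using U(1) x unfolding openin_iff by blast
  define s where "s N = (\<Sum>n<N. seq_scale (x n) (unit_seq n))" for N
  have s: "s N \<in> topspace X" for N unfolding s_def by (intro sum_mem scaled_unit_mem)
  have "(\<lambda>N. p m (s N - x)) \<longlonglongrightarrow> 0"
    using limitin_partial_sums[OF xX] limitin_iff[of s x, OF s xX] unfolding s_def by blast
  then have "eventually (\<lambda>N. p m (s N - x) < r / 2) sequentially"
    using r(1) by (intro order_tendstoD(2)) auto
  then obtain N where N: "p m (s N - x) < r / 2"
    by (auto simp: eventually_sequentially)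
  \<comment> \<open>\<open>N\<close> coefficients with errors below \<open>\<delta> n\<close> cost at most \<open>r / 2\<close> in total; the summand \<open>1\<close> avoids
    division by zero if \<open>p m\<close> vanishes at a unit sequence.\<close>
  define \<delta> where "\<delta> n = r / 2 / (real (Suc N) * (1 + p m (unit_seq n)))" for n
  have pos: "1 + p m (unit_seq n) > 0" for n using p_nonneg[OF unit_mem, of m n] by simp
  have "\<delta> n > 0" for n using pos[of n] r(1) unfolding \<delta>_def by (intro divide_pos_pos mult_pos_pos) auto
  then have "\<exists>d\<in>D. dist (x n) d < \<delta> n" for n
    using D[of "ball (x n) (\<delta> n)"] by (auto simp: not_le)
  then obtain d where d: "\<And>n. d n \<in> D" "\<And>n. dist (x n) (d n) < \<delta> n" by metis
  define u where "u = map d [0..<N]"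
  have "p m (seq_of_list u - s N) = p m (\<Sum>n<N. seq_scale (d n - x n) (unit_seq n))"
    unfolding seq_of_list_eq_sum s_def u_def
    by (simp add: sum_subtractf vs.scale_left_diff_distrib)
  also have "\<dots> \<le> (\<Sum>n<N. p m (seq_scale (d n - x n) (unit_seq n)))"
    by (intro p_sum scaled_unit_mem)
  also have "\<dots> \<le> (\<Sum>n<N. r / 2 / real (Suc N))"
  proof (rule sum_mono)
    fix n
    have "norm (d n - x n) * p m (unit_seq n) \<le> \<delta> n * (1 + p m (unit_seq n))"
      using d(2)[of n] p_nonneg[OF unit_mem, of m n]
      by (intro mult_mono) (auto simp: dist_norm norm_minus_commute intro: order_trans[OF norm_ge_zero less_imp_le])
    also have "\<dots> = r / 2 / real (Suc N)" using pos[of n] by (simp add: \<delta>_def)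
    finally show "p m (seq_scale (d n - x n) (unit_seq n)) \<le> r / 2 / real (Suc N)"
      by (simp add: p_scale unit_mem)
  qed
  also have "\<dots> \<le> r / 2" using r(1) by (simp add: field_simps)
  finally have "p m (seq_of_list u - s N) \<le> r / 2" .
  then have "p m (seq_of_list u - x) < r"
    using p_triangle[OF seq_of_list_mem s xX, of m u N] N by simp
  then have "seq_of_list u \<in> U" using r(2) seq_of_list_mem by blast
  moreover have "u \<in> lists D" using d(1) by (auto simp: u_def)
  ultimately show thesis by (rule that[rotated])
qed

lemma second_countable_X:
  fixes D :: "'a set"
  assumes "countable D" and D: "\<And>B. open B \<Longrightarrow> B \<noteq> {} \<Longrightarrow> \<exists>d\<in>D. d \<in> B"
  shows "second_countable X"
proof -
  define V where "V = (\<lambda>(u, m, q::nat). {y \<in> topspace X. p m (y - seq_of_list u) < 1 / real (Suc q)})"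
  define \<B> where "\<B> = V ` (lists D \<times> UNIV \<times> UNIV)"
  have "countable \<B>" unfolding \<B>_def using assms(1) by (intro countable_image countable_SIGMA) auto
  moreover have "openin X W" if "W \<in> \<B>" for W
    using that openin_ball[OF seq_of_list_mem] by (auto simp: \<B>_def V_def)
  moreover have "\<exists>W\<in>\<B>. x \<in> W \<and> W \<subseteq> U" if U: "openin X U" and x: "x \<in> U" for U x
  proof -
    have xX: "x \<in> topspace X" using x openin_subset[OF U] by blast
    obtain m r where r: "r > 0" "{y \<in> topspace X. p m (y - x) < r} \<subseteq> U"
      using U x unfolding openin_iff by blast
    obtain q where q: "1 / real (Suc q) < r / 2" using nat_approx_posE[of "r/2"] r(1) by auto
    let ?B = "{y \<in> topspace X. p m (y - x) < 1 / real (Suc q)}"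
    have "x \<in> ?B" using xX by (simp add: p_zero)
    then obtain u where u: "u \<in> lists D" "seq_of_list u \<in> ?B"
      using seq_of_list_dense[OF D openin_ball[OF xX]] by blast
    have "x \<in> V (u, m, q)" using u(2) xX p_commute[OF xX seq_of_list_mem] by (simp add: V_def)
    moreover have "V (u, m, q) \<subseteq> U"
    proof
      fix y assume "y \<in> V (u, m, q)"
      then have y: "y \<in> topspace X" "p m (y - seq_of_list u) < 1 / real (Suc q)"
        by (auto simp: V_def)
      then have "p m (y - x) < r"
        using p_triangle[OF y(1) seq_of_list_mem xX, of m u] u(2) q by simp
      then show "y \<in> U" using r(2) y(1) by blast
    qed
    ultimately show ?thesis using u(1) by (force simp: \<B>_def)
  qed
  ultimately show ?thesis unfolding second_countable_def by blast
qed

end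


section \<open>Sequences of iterated weighted shifts\<close>

locale shift_sequence = frechet_seq_basis X p
  for X :: "(nat \<Rightarrow> 'k::real_normed_field) topology" and p +
  fixes S :: "nat \<Rightarrow> (nat \<Rightarrow> 'k) \<Rightarrow> nat \<Rightarrow> 'k" and c :: "nat \<Rightarrow> nat \<Rightarrow> 'k"
  assumes S_apply: "S n x j = c n j * x (n + j)"
    and c_nonzero: "c n j \<noteq> 0"
    and S_cont: "continuous_map X X (S n)"
begin

text \<open>
  The terms of the basis expansion of the universal vector itself serve as majorants. They are
  small only for large \<open>n\<close>, so the orbit has to be near a vector with nonzero first coordinates at
  arbitrarily late times; a target with large coordinates, out of reach of the first \<open>N\<close> points of
  the orbit, enforces this.
\<close>

lemma universal_imp_tendsto:
  assumes "universal X S"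
  obtains m where "strict_mono m" "\<And>i. m i \<ge> 1"
    "\<And>j. limitin X (\<lambda>i. seq_scale (inverse (c (m i) j)) (unit_seq (m i + j))) 0 sequentially"
proof -
  obtain x where x: "x \<in> topspace X" and dense: "X closure_of {S n x | n. n \<ge> 1} = topspace X"
    using assms unfolding universal_def by blast
  have step: "\<exists>n\<ge>N. 1 \<le> n \<and> (\<forall>j\<le>J. 1/2 \<le> norm (S n x j))" for N J
  proof -
    \<comment> \<open>\<open>C\<close> exceeds \<open>norm (S n x 0)\<close> by at least \<open>1\<close> for all \<open>n < N\<close>, so that \<open>S n x \<in> V\<close>
      forces \<open>n \<ge> N\<close>.\<close>
    define C where "C = 1 + (\<Sum>n<N. norm (S n x 0))"
    have C: "C \<ge> 1" by (simp add: C_def sum_nonneg)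
    define V where "V = (\<Inter>j\<in>{..J}. {y \<in> topspace X. y j \<in> ball (of_real C) (1/2)})"
    have "openin X V" unfolding V_def by (intro openin_INT2 openin_coordinate) auto
    moreover have "seq_of_list (replicate (Suc J) (of_real C)) \<in> V"
    proof -
      have "seq_of_list (replicate (Suc J) (of_real C)) j = (of_real C :: 'k)" if "j \<le> J" for j
        using that by (simp add: seq_of_list_def del: replicate_Suc)
      then show ?thesis
        using seq_of_list_mem unfolding V_def by (auto simp del: replicate_Suc)
    qed
    ultimately obtain n where n: "n \<ge> 1" "S n x \<in> V"
      using dense unfolding dense_intersects_open by blast
    have close: "C - norm (S n x j) < 1/2" if "j \<le> J" for j
    proof -
      have "norm (of_real C - S n x j) < 1/2" using n(2) that by (auto simp: V_def dist_norm)
      then show ?thesis using norm_triangle_ineq2[of "of_real C" "S n x j"] C by simp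
    qed
    have "n \<ge> N"
    proof (rule ccontr)
      assume "\<not> n \<ge> N"
      then have "norm (S n x 0) \<le> (\<Sum>n<N. norm (S n x 0))"
        by (intro member_le_sum) auto
      then show False using close[of 0] by (simp add: C_def)
    qed
    moreover have "1/2 \<le> norm (S n x j)" if "j \<le> J" for j using close[OF that] C by simp
    ultimately show ?thesis using n(1) by blast
  qed
  have "\<exists>m. \<forall>i. (1 \<le> m i \<and> (\<forall>j\<le>i. 1/2 \<le> norm (S (m i) x j))) \<and> m i < m (Suc i)"
  proof (rule dependent_nat_choice)
    show "\<exists>n. 1 \<le> n \<and> (\<forall>j\<le>0. 1/2 \<le> norm (S n x j))" using step[of 0 0] by blast
    show "\<exists>n'. (1 \<le> n' \<and> (\<forall>j\<le>Suc i. 1/2 \<le> norm (S n' x j))) \<and> n < n'" for n i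
      using step[of "Suc n" "Suc i"] by (auto simp: Suc_le_eq)
  qed
  then obtain m where m: "\<And>i. 1 \<le> m i" "\<And>i j. j \<le> i \<Longrightarrow> 1/2 \<le> norm (S (m i) x j)"
    "\<And>i. m i < m (Suc i)"
    by blast
  have mono: "strict_mono m" using m(3) by (simp add: strict_mono_Suc_iff)
  moreover have "limitin X (\<lambda>i. seq_scale (inverse (c (m i) j)) (unit_seq (m i + j))) 0 sequentially" for j
    unfolding limitin_0_iff[OF scaled_unit_mem]
  proof
    fix q
    have "strict_mono (\<lambda>i. m i + j)" using mono by (simp add: strict_mono_def)
    then have lim: "(\<lambda>i. 2 * p q (seq_scale (x (m i + j)) (unit_seq (m i + j)))) \<longlonglongrightarrow> 0"
      using LIMSEQ_subseq_LIMSEQ[OF basis_terms_tendsto_0[OF x, of q]]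
      by (intro tendsto_mult_right_zero) (auto simp: o_def)
    have le: "p q (seq_scale (inverse (c (m i) j)) (unit_seq (m i + j)))
        \<le> 2 * p q (seq_scale (x (m i + j)) (unit_seq (m i + j)))" if "i \<ge> j" for i
    proof -
      have "1/2 \<le> norm (c (m i) j) * norm (x (m i + j))"
        using m(2)[OF that] by (simp add: S_apply norm_mult)
      then have "inverse (norm (c (m i) j)) \<le> 2 * norm (x (m i + j))"
        using c_nonzero[of "m i" j] by (simp add: field_simps)
      then have "inverse (norm (c (m i) j)) * p q (unit_seq (m i + j))
          \<le> 2 * norm (x (m i + j)) * p q (unit_seq (m i + j))"
        by (intro mult_right_mono p_nonneg unit_mem)
      then show ?thesis by (simp add: p_scale unit_mem norm_inverse)
    qed
    show "(\<lambda>i. p q (seq_scale (inverse (c (m i) j)) (unit_seq (m i + j)))) \<longlonglongrightarrow> 0"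
      by (rule tendsto_sandwich[OF _ _ tendsto_const lim])
        (use le in \<open>auto intro!: always_eventually p_nonneg scaled_unit_mem
          simp: eventually_sequentially\<close>)
  qed
  ultimately show thesis using m(1) that by blast
qed

text \<open>A preimage of \<open>seq_of_list v\<close> under \<open>S n\<close>, supported on \<open>{n..}\<close>.\<close>

definition right_inverse :: "nat \<Rightarrow> 'k list \<Rightarrow> nat \<Rightarrow> 'k"
  where "right_inverse n v =
    (\<Sum>j<length v. seq_scale (v ! j) (seq_scale (inverse (c n j)) (unit_seq (n + j))))"

lemma right_inverse_mem: "right_inverse n v \<in> topspace X"
  unfolding right_inverse_def by (intro sum_mem scale_mem unit_mem)

lemma S_add_right_inverse:
  assumes "length u \<le> n"
  shows "S n (seq_of_list u + right_inverse n v) = seq_of_list v"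
proof
  fix i
  have "right_inverse n v (n + i) = (\<Sum>j<length v. if j = i then v ! j * inverse (c n j) else 0)"
    unfolding right_inverse_def sum_seq_apply
    by (intro sum.cong) (auto simp: seq_scale_def unit_seq_def)
  then have "right_inverse n v (n + i) = inverse (c n i) * seq_of_list v i"
    by (simp add: seq_of_list_def)
  moreover have "seq_of_list u (n + i) = 0" using assms by (simp add: seq_of_list_def)
  ultimately show "S n (seq_of_list u + right_inverse n v) i = seq_of_list v i"
    using c_nonzero[of n i] by (simp add: S_apply)
qed

lemma tendsto_imp_weakly_mixing:
  assumes m: "strict_mono m" "\<And>i. m i \<ge> 1"
    and lim: "\<And>j. limitin X (\<lambda>i. seq_scale (inverse (c (m i) j)) (unit_seq (m i + j))) 0 sequentially"
  shows "weakly_mixing X S"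
proof -
  have dense: "\<exists>u. seq_of_list u \<in> U" if "openin X U" "U \<noteq> {}" for U
    using seq_of_list_dense[of UNIV U] that by auto
  have p_lim: "(\<lambda>i. p q (right_inverse (m i) v)) \<longlonglongrightarrow> 0" for q v
  proof -
    have "(\<lambda>i. p q (seq_scale (inverse (c (m i) j)) (unit_seq (m i + j)))) \<longlonglongrightarrow> 0" for j
      using lim[of j] unfolding limitin_0_iff[OF scaled_unit_mem] by blast
    then have lim0: "(\<lambda>i. \<Sum>j<length v. norm (v ! j) *
        p q (seq_scale (inverse (c (m i) j)) (unit_seq (m i + j)))) \<longlonglongrightarrow> 0"
      by (intro tendsto_null_sum tendsto_mult_right_zero)
    have "p q (right_inverse (m i) v)
        \<le> (\<Sum>j<length v. norm (v ! j) * p q (seq_scale (inverse (c (m i) j)) (unit_seq (m i + j))))" for i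
      unfolding right_inverse_def p_scale[OF scaled_unit_mem, symmetric]
      by (intro p_sum scale_mem unit_mem)
    then show ?thesis
      by (intro tendsto_sandwich[OF _ _ tendsto_const lim0])
        (auto intro!: always_eventually p_nonneg right_inverse_mem)
  qed
  have hit: "eventually (\<lambda>i. S (m i) ` U \<inter> V \<noteq> {}) sequentially"
    if U: "openin X U" "U \<noteq> {}" and V: "openin X V" "V \<noteq> {}" for U V
  proof -
    obtain u where u: "seq_of_list u \<in> U" using dense[OF U] by blast
    obtain v where v: "seq_of_list v \<in> V" using dense[OF V] by blast
    have "limitin X (\<lambda>i. seq_of_list u + right_inverse (m i) v) (seq_of_list u) sequentially"
      using p_lim[of _ v] by (subst limitin_iff) (auto intro: seq_of_list_mem add_mem right_inverse_mem)
    then have "eventually (\<lambda>i. seq_of_list u + right_inverse (m i) v \<in> U) sequentially"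
      using U(1) u unfolding limitin_def by blast
    moreover have "eventually (\<lambda>i. length u \<le> m i) sequentially"
      using filterlim_subseq[OF m(1)] by (auto simp: filterlim_at_top)
    ultimately show ?thesis
    proof eventually_elim
      case (elim i)
      have "seq_of_list v \<in> S (m i) ` U"
        using imageI[OF elim(1), of "S (m i)"] unfolding S_add_right_inverse[OF elim(2)] .
      then show ?case using v by blast
    qed
  qed
  show ?thesis
    unfolding weakly_mixing_def
  proof (intro allI impI, elim conjE)
    fix U1 U2 V1 V2
    assume "openin X U1" "openin X U2" "openin X V1" "openin X V2"
      "U1 \<noteq> {}" "U2 \<noteq> {}" "V1 \<noteq> {}" "V2 \<noteq> {}"
    then have "eventually (\<lambda>i. S (m i) ` U1 \<inter> V1 \<noteq> {} \<and> S (m i) ` U2 \<inter> V2 \<noteq> {}) sequentially"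
      by (intro eventually_conj hit)
    then obtain i where "S (m i) ` U1 \<inter> V1 \<noteq> {}" "S (m i) ` U2 \<inter> V2 \<noteq> {}"
      unfolding eventually_sequentially by blast
    with m(2)[of i] show "\<exists>n\<ge>1. S n ` U1 \<inter> V1 \<noteq> {} \<and> S n ` U2 \<inter> V2 \<noteq> {}"
      by blast
  qed
qed

lemma weakly_mixing_imp_universal:
  fixes D :: "'k set"
  assumes "weakly_mixing X S"
    and "countable D" "\<And>B. open B \<Longrightarrow> B \<noteq> {} \<Longrightarrow> \<exists>d\<in>D. d \<in> B"
  shows "universal X S"
proof (rule transitive_imp_universal[OF completely_metrizable])
  show "second_countable X" by (rule second_countable_X) (use assms in auto)
  show "topspace X \<noteq> {}" using zero_mem by blast
  show "\<exists>n\<ge>1. S n ` U \<inter> V \<noteq> {}"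
    if "openin X U" "openin X V" "U \<noteq> {}" "V \<noteq> {}" for U V
  proof -
    from assms(1) that have "\<exists>n\<ge>1. S n ` U \<inter> V \<noteq> {} \<and> S n ` U \<inter> V \<noteq> {}"
      unfolding weakly_mixing_def by metis
    then show ?thesis by blast
  qed
qed (rule S_cont)

end


section \<open>Random products of weighted shifts\<close>

lemma random_product_shift_apply:
  "random_product \<tau> (random_shift k A w) n \<omega> x j =
    (\<Prod>l = Suc j..n + j. random_weight k A w l ((\<tau> ^^ (n + j - l)) \<omega>)) * x (n + j)"
proof (induction n arbitrary: j)
  case (Suc n)
  have "random_product \<tau> (random_shift k A w) (Suc n) \<omega> x j =
      random_weight k A w (Suc j) ((\<tau> ^^ n) \<omega>) * random_product \<tau> (random_shift k A w) n \<omega> x (Suc j)"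
    by (simp add: random_shift_def random_weight_def weighted_shift_def)
  also have "\<dots> = (random_weight k A w (Suc j) ((\<tau> ^^ n) \<omega>) *
      (\<Prod>l = Suc (Suc j)..Suc n + j. random_weight k A w l ((\<tau> ^^ (Suc n + j - l)) \<omega>))) * x (Suc n + j)"
    by (simp add: Suc)
  also have "\<dots> = (\<Prod>l = Suc j..Suc n + j. random_weight k A w l ((\<tau> ^^ (Suc n + j - l)) \<omega>)) * x (Suc n + j)"
    by (subst (2) prod.atLeast_Suc_atMost) simp_all
  finally show ?case .
qed simp

lemma continuous_map_random_product:
  assumes "\<And>n. continuous_map X X (R ((\<tau> ^^ n) \<omega>))"
  shows "continuous_map X X (random_product \<tau> R n \<omega>)"
  by (induction n) (simp_all add: id_def continuous_map_compose assms del: o_apply)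

text \<open>
  There are only finitely many choice functions \<open>g\<close> on \<open>{1..j}\<close>, so the norms of the products form
  a finite set of positive numbers. It is empty if \<open>I\<close> is empty and \<open>j > 0\<close>; inserting \<open>1\<close> keeps the
  extrema meaningful in that case.
\<close>

lemma prod_norm_bounds:
  fixes f :: "nat \<Rightarrow> 'i \<Rightarrow> 'k::real_normed_field"
  assumes "finite I" "\<And>l i. l \<in> {1..j} \<Longrightarrow> i \<in> I \<Longrightarrow> f l i \<noteq> 0"
  shows "\<exists>a>0. \<exists>b>0. \<forall>g \<in> {1..j} \<rightarrow> I.
    a \<le> norm (\<Prod>l = 1..j. f l (g l)) \<and> norm (\<Prod>l = 1..j. f l (g l)) \<le> b"
proof -
  define P where "P = (\<lambda>g. norm (\<Prod>l = 1..j. f l (g l))) ` ({1..j} \<rightarrow>\<^sub>E I)"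
  have fin: "finite P" unfolding P_def using assms(1) by (intro finite_imageI finite_PiE) auto
  have pos: "x > 0" if "x \<in> P" for x
    using that assms unfolding P_def by (auto simp: prod_zero_iff PiE_def Pi_def)
  have P: "norm (\<Prod>l = 1..j. f l (g l)) \<in> P" if "g \<in> {1..j} \<rightarrow> I" for g
  proof -
    have "(\<Prod>l = 1..j. f l (g l)) = (\<Prod>l = 1..j. f l (restrict g {1..j} l))"
      by (intro prod.cong) auto
    then show ?thesis unfolding P_def using that by (intro image_eqI[of _ _ "restrict g {1..j}"]) auto
  qed
  show ?thesis
  proof (intro exI conjI ballI)
    show "Min (insert 1 P) > 0" "Max (insert 1 P) > 0"
      using fin pos by (auto simp: Max_gr_iff)
    show "Min (insert 1 P) \<le> norm (\<Prod>l = 1..j. f l (g l))"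
      "norm (\<Prod>l = 1..j. f l (g l)) \<le> Max (insert 1 P)" if "g \<in> {1..j} \<rightarrow> I" for g
      using P[OF that] fin by auto
  qed
qed

lemma (in frechet_seq_basis) limitin_scaled_units_cong:
  assumes ab: "a > 0"
    and g: "\<And>i. a \<le> norm (g i)" "\<And>i. norm (g i) \<le> b"
  shows "limitin X (\<lambda>i. seq_scale (g i * h i) (unit_seq (m i))) 0 sequentially \<longleftrightarrow>
    limitin X (\<lambda>i. seq_scale (h i) (unit_seq (m i))) 0 sequentially"
proof -
  define P where "P q i = norm (h i) * p q (unit_seq (m i))" for q i
  have P0: "0 \<le> P q i" for q i by (simp add: P_def p_nonneg unit_mem)
  have P: "p q (seq_scale (h i) (unit_seq (m i))) = P q i"
    "p q (seq_scale (g i * h i) (unit_seq (m i))) = norm (g i) * P q i" for q i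
    by (simp_all add: P_def p_scale unit_mem norm_mult)
  have "(\<lambda>i. norm (g i) * P q i) \<longlonglongrightarrow> 0 \<longleftrightarrow> P q \<longlonglongrightarrow> 0" for q
  proof
    assume "(\<lambda>i. norm (g i) * P q i) \<longlonglongrightarrow> 0"
    then have L: "(\<lambda>i. inverse a * (norm (g i) * P q i)) \<longlonglongrightarrow> 0" by (rule tendsto_mult_right_zero)
    have "P q i \<le> inverse a * (norm (g i) * P q i)" for i
      using mult_right_mono[OF g(1)[of i] P0[of q i]] ab by (simp add: field_simps)
    then show "P q \<longlonglongrightarrow> 0"
      by (intro tendsto_sandwich[OF _ _ tendsto_const L] always_eventually allI P0)
  next
    assume "P q \<longlonglongrightarrow> 0"
    then have L: "(\<lambda>i. b * P q i) \<longlonglongrightarrow> 0" by (rule tendsto_mult_right_zero)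
    show "(\<lambda>i. norm (g i) * P q i) \<longlonglongrightarrow> 0"
      by (intro tendsto_sandwich[OF _ _ tendsto_const L] always_eventually allI
          mult_right_mono g(2) P0 mult_nonneg_nonneg norm_ge_zero)
  qed
  then show ?thesis unfolding limitin_0_iff[OF scaled_unit_mem] P by simp
qed

theorem theorem1p1:
  fixes X :: "(nat \<Rightarrow> 'k::{real_normed_field, euclidean_space}) topology"
    and M :: "'a measure" and \<tau> :: "'a \<Rightarrow> 'a"
    and k :: nat and A :: "nat \<Rightarrow> 'a set" and w :: "nat \<Rightarrow> nat \<Rightarrow> 'k" and \<omega> :: 'a
  assumes "frechet_sequence_space X"
    and "schauder_basis X unit_seq"
    and "measure_preserving_system M \<tau>"
    and "k \<ge> 1"
    and "measurable_partition M k A"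
    and "\<And>l. l \<in> {1..k} \<Longrightarrow> measure M (A l) > 0"
    and "\<And>l n. l \<in> {1..k} \<Longrightarrow> n \<ge> 1 \<Longrightarrow> w l n \<noteq> 0"
    and "\<And>l. l \<in> {1..k} \<Longrightarrow> continuous_map X X (weighted_shift (w l))"
    and "\<omega> \<in> space M"
  defines "T \<equiv> \<lambda>n. random_product \<tau> (random_shift k A w) n \<omega>"
    and "\<epsilon> \<equiv> random_weight k A w"
  shows "(universal X T \<longleftrightarrow> weakly_mixing X T) \<and>
    (weakly_mixing X T \<longleftrightarrow>
      (\<exists>m :: nat \<Rightarrow> nat. strict_mono m \<and> (\<forall>i. m i \<ge> 1) \<and>
        (\<forall>j. limitin X
          (\<lambda>i. seq_scale (inverse (\<Prod>l = 1..m i + j. \<epsilon> l ((\<tau> ^^ (m i + j - l)) \<omega>)))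
                 (unit_seq (m i + j)))
          0 sequentially)))"
proof -
  obtain p where p: "frechet_seminorms X p"
    using assms(1) unfolding frechet_sequence_space_def by blast
  define c where "c n j = (\<Prod>l = Suc j..n + j. \<epsilon> l ((\<tau> ^^ (n + j - l)) \<omega>))" for n j
  have \<tau>: "\<tau> \<in> measurable M M" using assms(3) by (simp add: measure_preserving_system_def)
  have orbit: "(\<tau> ^^ n) \<omega> \<in> space M" for n
    by (induction n) (use assms(9) measurable_space[OF \<tau>] in auto)
  have cell: "cell k A ((\<tau> ^^ n) \<omega>) \<in> {1..k}" for n
  proof -
    obtain l where l: "l \<in> {1..k}" "(\<tau> ^^ n) \<omega> \<in> A l"
      using orbit[of n] assms(5) unfolding measurable_partition_def by blast
    then show ?thesis using cell_eq[OF assms(5) l] by simp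
  qed
  interpret shift_sequence X p T c
  proof
    show "frechet_sequence_space X" "frechet_seminorms X p" "schauder_basis X unit_seq"
      by (rule assms p)+
    show "T n x j = c n j * x (n + j)" for n x j
      by (simp add: T_def c_def \<epsilon>_def random_product_shift_apply)
    show "c n j \<noteq> 0" for n j
      using assms(7)[OF cell] by (auto simp: c_def \<epsilon>_def random_weight_def)
    show "continuous_map X X (T n)" for n
      unfolding T_def random_shift_def
      by (intro continuous_map_random_product assms(8) cell)
  qed
  have full: "limitin X
      (\<lambda>i. seq_scale (inverse (\<Prod>l = 1..m i + j. \<epsilon> l ((\<tau> ^^ (m i + j - l)) \<omega>))) (unit_seq (m i + j)))
      0 sequentially \<longleftrightarrow>
    limitin X (\<lambda>i. seq_scale (inverse (c (m i) j)) (unit_seq (m i + j))) 0 sequentially"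
    for m :: "nat \<Rightarrow> nat" and j
  proof -
    \<comment> \<open>the \<open>j\<close> factors of the full product that are missing in \<open>c (m i) j\<close>\<close>
    define h where "h i = (\<Prod>l = 1..j. w (cell k A ((\<tau> ^^ (m i + j - l)) \<omega>)) l)" for i
    obtain a b where ab: "a > 0" "b > 0" and bounds: "\<And>g. g \<in> {1..j} \<rightarrow> {1..k} \<Longrightarrow>
      a \<le> norm (\<Prod>l = 1..j. w (g l) l) \<and> norm (\<Prod>l = 1..j. w (g l) l) \<le> b"
    proof -
      have "\<exists>a>0. \<exists>b>0. \<forall>g \<in> {1..j} \<rightarrow> {1..k}.
          a \<le> norm (\<Prod>l = 1..j. w (g l) l) \<and> norm (\<Prod>l = 1..j. w (g l) l) \<le> b"
        by (rule prod_norm_bounds) (use assms(7) in auto)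
      then show thesis using that by blast
    qed
    have h: "a \<le> norm (h i)" "norm (h i) \<le> b" for i
      unfolding h_def using bounds[OF Pi_I[OF cell]] by blast+
    have split: "(\<Prod>l = 1..m i + j. \<epsilon> l ((\<tau> ^^ (m i + j - l)) \<omega>)) = h i * c (m i) j" for i
    proof -
      have "{1..m i + j} = {1..j} \<union> {Suc j..m i + j}" "{1..j} \<inter> {Suc j..m i + j} = {}" by auto
      then show ?thesis
        by (simp add: prod.union_disjoint h_def c_def \<epsilon>_def random_weight_def)
    qed
    have "inverse b \<le> norm (inverse (h i))" "norm (inverse (h i)) \<le> inverse a" for i
      using h[of i] ab by (auto simp: norm_inverse intro!: le_imp_inverse_le)
    then show ?thesis
      unfolding split inverse_mult_distrib
      using ab by (intro limitin_scaled_units_cong[of "inverse b"]) auto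
  qed
  obtain D :: "'k set" where D: "countable D" "\<And>B. open B \<Longrightarrow> B \<noteq> {} \<Longrightarrow> \<exists>d\<in>D. d \<in> B"
    using countable_dense_setE by blast
  have "weakly_mixing X T \<Longrightarrow> universal X T"
    by (rule weakly_mixing_imp_universal[OF _ D])
  moreover have "weakly_mixing X T" if "\<exists>m. strict_mono m \<and> (\<forall>i. m i \<ge> 1) \<and>
    (\<forall>j. limitin X (\<lambda>i. seq_scale (inverse (c (m i) j)) (unit_seq (m i + j))) 0 sequentially)"
    using that tendsto_imp_weakly_mixing by blast
  moreover have "\<exists>m. strict_mono m \<and> (\<forall>i. m i \<ge> 1) \<and>
    (\<forall>j. limitin X (\<lambda>i. seq_scale (inverse (c (m i) j)) (unit_seq (m i + j))) 0 sequentially)"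
    if "universal X T"
    using universal_imp_tendsto[OF that] by metis
  ultimately show ?thesis
    unfolding full by blast
qed

end
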